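(* Let $\mathbf{k}$ be a field. The category $\mathcal{A}$ is locally noetherian; that is, every object is the union of its finitely generated subobjects and every finitely generated object of $\mathcal{A}$ satisfies the ascending chain condition on subobjects.
   Context: Let $\mathfrak{S}=\bigcup_{n\ge1}\mathfrak{S}_n$ be the infinite symmetric group (finitary permutations of $\{1,2,\ldots\}$), and $\mathfrak{S}^n\subset\mathfrak{S}$ the subgroup fixing each of $1,\ldots,n$. Let $\mathbf{K}=\mathbf{k}(\xi_1,\xi_2,\ldots)$, on which $\mathfrak{S}$ acts by permuting variables. $\mathcal{A}$ is the category of smooth $\mathbf{K}$-semilinear representations of $\mathfrak{S}$: $\mathbf{K}$-vector spaces $M$ with an additive action of $\mathfrak{S}$ satisfying $\sigma(av)=(\sigma a)(\sigma v)$, such that every $v\in M$ is fixed by $\mathfrak{S}^n$ for some $n$. Morphisms are $\mathbf{K}$-linear $\mathfrak{S}$-equivariant maps. $M$ is finitely generated if it is the $\mathbf{K}$-span of the $\mathfrak{S}$-orbits of finitely many elements. *)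

theory Defs
  imports
    "HOL.Vector_Spaces"
    "HOL-Combinatorics.Perm"
    "HOL-Library.Poly_Mapping"
    "HOL-Computational_Algebra.Fraction_Field"
begin

unbundle permutation_syntax

text \<open>
  The infinite symmetric group is the type \<open>nat perm\<close> of finitary permutations. Variables are
  indexed from 0: \<open>rat_var i\<close> below is the variable \<open>\<xi>\<^sub>i\<^sub>+\<^sub>1\<close> of the usual notation, and
  \<open>\<SS>\<^sup>n\<close> consists of the permutations that fix every \<open>i < n\<close>.
\<close>

definition fixing_subgroup :: "nat \<Rightarrow> nat perm set" where
  "fixing_subgroup n = {\<sigma>. \<forall>i<n. \<sigma> \<langle>$\<rangle> i = i}"


section \<open>The rational function field and its permutation action\<close>

text \<open>
  A monomial is its finitely supported exponent vector, and a polynomial its finitely supported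
  family of coefficients. The linear order on monomials that makes this ring an integral domain
  in the library is only a technical device.
\<close>

type_synonym monom = "nat \<Rightarrow>\<^sub>0 nat"
type_synonym 'k mpoly = "monom \<Rightarrow>\<^sub>0 'k"
type_synonym 'k ratfun = "'k mpoly fract"

text \<open>
  The exponent of \<open>\<sigma> i\<close> in \<open>\<sigma> m\<close> is the exponent of \<open>i\<close> in \<open>m\<close>, and the coefficient of \<open>\<sigma> m\<close>
  in \<open>\<sigma> p\<close> is the coefficient of \<open>m\<close> in \<open>p\<close>; hence the inverses.
\<close>

definition perm_monom :: "nat perm \<Rightarrow> monom \<Rightarrow> monom" where
  "perm_monom \<sigma> m = Poly_Mapping.map_key (apply (inverse \<sigma>)) m"

definition perm_poly :: "nat perm \<Rightarrow> 'k::zero mpoly \<Rightarrow> 'k mpoly" where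
  "perm_poly \<sigma> p = Poly_Mapping.map_key (perm_monom (inverse \<sigma>)) p"

lemma poly_mapping_add_induct [case_names zero add]:
  fixes f :: "'a \<Rightarrow>\<^sub>0 'b::monoid_add"
  assumes "P 0" and "\<And>a b f. P f \<Longrightarrow> P (Poly_Mapping.single a b + f)"
  shows "P f"
proof (induction f rule: update_induct)
  case (update f a b)
  then have "Poly_Mapping.update a b f = Poly_Mapping.single a b + f"
    by (intro poly_mapping_eqI)
      (auto simp: lookup_update lookup_add lookup_single in_keys_iff when_def)
  with update assms show ?case by simp
qed (fact assms)

lemma inj_apply: "inj (apply (\<sigma> :: 'a perm))"
  by (simp add: bij_is_inj)

lemma perm_inverse_inverse [simp]: "inverse (inverse \<sigma>) = (\<sigma> :: 'a perm)"
  by (rule perm.inverse_inverse)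

lemma perm_monom_one [simp]: "perm_monom 1 m = m"
proof -
  have "inverse (1 :: nat perm) = 1" by (rule perm.inverse_neutral)
  then show ?thesis
    using map_key_id[of m] by (simp add: perm_monom_def id_def)
qed

lemma perm_monom_mult: "perm_monom (\<sigma> * \<tau>) m = perm_monom \<sigma> (perm_monom \<tau> m)"
  by (simp add: perm_monom_def map_key_compose inj_apply apply_times)

lemma perm_monom_inverse [simp]:
  "perm_monom (inverse \<sigma>) (perm_monom \<sigma> m) = m" "perm_monom \<sigma> (perm_monom (inverse \<sigma>) m) = m"
  by (simp_all flip: perm_monom_mult)

lemma inj_perm_monom: "inj (perm_monom \<sigma>)"
  by (metis injI perm_monom_inverse(1))

lemma perm_monom_add: "perm_monom \<sigma> (m + n) = perm_monom \<sigma> m + perm_monom \<sigma> n"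
  by (simp add: perm_monom_def map_key_plus inj_apply)

lemma perm_monom_zero [simp]: "perm_monom \<sigma> 0 = 0"
  by (simp add: perm_monom_def inj_apply)

lemma perm_monom_single [simp]:
  "perm_monom \<sigma> (Poly_Mapping.single i e) = Poly_Mapping.single (\<sigma> \<langle>$\<rangle> i) e"
proof -
  have "i = inverse \<sigma> \<langle>$\<rangle> (\<sigma> \<langle>$\<rangle> i)"
    by (simp add: apply_sequence)
  then show ?thesis
    using map_key_single[OF inj_apply[of "inverse \<sigma>"], of "\<sigma> \<langle>$\<rangle> i" e]
    by (simp add: perm_monom_def)
qed

lemma perm_poly_one [simp]: "perm_poly 1 p = p"
proof -
  have "perm_monom (inverse 1) = (\<lambda>m. m)"
    by (simp add: fun_eq_iff perm.inverse_neutral)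
  then show ?thesis by (simp add: perm_poly_def map_key_id)
qed

lemma perm_poly_mult_perm: "perm_poly (\<sigma> * \<tau>) p = perm_poly \<sigma> (perm_poly \<tau> p)"
  by (simp add: perm_poly_def map_key_compose inj_perm_monom comp_def flip: perm_monom_mult)

lemma perm_poly_inverse [simp]: "perm_poly (inverse \<sigma>) (perm_poly \<sigma> p) = p"
  by (simp flip: perm_poly_mult_perm)

lemma perm_poly_zero [simp]: "perm_poly \<sigma> 0 = 0"
  by (simp add: perm_poly_def inj_perm_monom)

lemma perm_poly_eq_0_iff [simp]: "perm_poly \<sigma> p = 0 \<longleftrightarrow> p = 0"
  by (metis perm_poly_inverse perm_poly_zero)

lemma perm_poly_add:
  "perm_poly \<sigma> (p + q) = perm_poly \<sigma> p + perm_poly \<sigma> (q :: 'k::monoid_add mpoly)"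
  by (simp add: perm_poly_def map_key_plus inj_perm_monom)

lemma perm_poly_single [simp]:
  "perm_poly \<sigma> (Poly_Mapping.single m c) = Poly_Mapping.single (perm_monom \<sigma> m) c"
  using map_key_single[OF inj_perm_monom[of "inverse \<sigma>"], of "perm_monom \<sigma> m" c]
  by (simp add: perm_poly_def)

lemma perm_poly_mult:
  fixes p q :: "'k::comm_semiring_0 mpoly"
  shows "perm_poly \<sigma> (p * q) = perm_poly \<sigma> p * perm_poly \<sigma> q"
proof (induction p rule: poly_mapping_add_induct)
  case (add m c p)
  have "perm_poly \<sigma> (Poly_Mapping.single m c * q)
      = perm_poly \<sigma> (Poly_Mapping.single m c) * perm_poly \<sigma> q"
    by (induction q rule: poly_mapping_add_induct)
      (simp_all add: mult_single perm_monom_add perm_poly_add distrib_left)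
  with add show ?case by (simp add: perm_poly_add distrib_right)
qed simp

lift_definition perm_rat :: "nat perm \<Rightarrow> 'k::field ratfun \<Rightarrow> 'k ratfun"
  is "\<lambda>\<sigma> (p, q). (perm_poly \<sigma> p, perm_poly \<sigma> q)"
  by (auto simp flip: perm_poly_mult)

definition rat_const :: "'k::field \<Rightarrow> 'k ratfun" where
  "rat_const c = Fract (Poly_Mapping.single 0 c) 1"

definition rat_var :: "nat \<Rightarrow> 'k::field ratfun" where
  "rat_var i = Fract (Poly_Mapping.single (Poly_Mapping.single i 1) 1) 1"

lemma perm_poly_1 [simp]: "perm_poly \<sigma> (1 :: 'k::comm_semiring_1 mpoly) = 1"
  by (simp flip: single_one)

lemma perm_rat_Fract: "perm_rat \<sigma> (Fract p q) = Fract (perm_poly \<sigma> p) (perm_poly \<sigma> q)"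
  by transfer simp

text \<open>
  The action is by field automorphisms, is trivial on constants and permutes the variables,
  which determines it.
\<close>

lemma perm_rat_const: "perm_rat \<sigma> (rat_const c) = rat_const c"
  by (simp add: rat_const_def perm_rat_Fract)

lemma perm_rat_var: "perm_rat \<sigma> (rat_var i) = rat_var (\<sigma> \<langle>$\<rangle> i)"
  by (simp add: rat_var_def perm_rat_Fract)

lemma perm_rat_add: "perm_rat \<sigma> (a + b) = perm_rat \<sigma> a + perm_rat \<sigma> b"
  by (cases a; cases b) (simp add: perm_rat_Fract perm_poly_add perm_poly_mult)

lemma perm_rat_mult: "perm_rat \<sigma> (a * b) = perm_rat \<sigma> a * perm_rat \<sigma> b"
  by (cases a; cases b) (simp add: perm_rat_Fract perm_poly_mult)

lemma perm_rat_one [simp]: "perm_rat 1 a = a"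
  by (cases a) (simp add: perm_rat_Fract)

lemma perm_rat_mult_perm: "perm_rat (\<sigma> * \<tau>) a = perm_rat \<sigma> (perm_rat \<tau> a)"
  by (cases a) (simp add: perm_rat_Fract perm_poly_mult_perm)


section \<open>Smooth semilinear representations\<close>

locale smooth_semilinear_rep = vector_space scale
  for scale :: "'k::field ratfun \<Rightarrow> 'm::ab_group_add \<Rightarrow> 'm" +
  fixes act :: "nat perm \<Rightarrow> 'm \<Rightarrow> 'm"
  assumes act_one: "act 1 v = v"
    and act_mult: "act (\<sigma> * \<tau>) v = act \<sigma> (act \<tau> v)"
    and act_add: "act \<sigma> (v + w) = act \<sigma> v + act \<sigma> w"
    and act_scale: "act \<sigma> (scale a v) = scale (perm_rat \<sigma> a) (act \<sigma> v)"
    and smooth: "\<exists>n. \<forall>\<sigma>\<in>fixing_subgroup n. act \<sigma> v = v"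
begin

text \<open>Smoothness is inherited by stable subspaces, so these are exactly the subobjects.\<close>

definition subobject :: "'m set \<Rightarrow> bool" where
  "subobject N \<longleftrightarrow> subspace N \<and> (\<forall>\<sigma>. \<forall>v\<in>N. act \<sigma> v \<in> N)"

definition finitely_generated :: "'m set \<Rightarrow> bool" where
  "finitely_generated N \<longleftrightarrow> (\<exists>G. finite G \<and> N = span {act \<sigma> v | \<sigma> v. v \<in> G})"

definition acc_on_subobjects :: "'m set \<Rightarrow> bool" where
  "acc_on_subobjects N \<longleftrightarrow>
    (\<forall>C :: nat \<Rightarrow> 'm set.
      (\<forall>i. subobject (C i) \<and> C i \<subseteq> N \<and> C i \<subseteq> C (Suc i)) \<longrightarrow> (\<exists>n. \<forall>i\<ge>n. C i = C n))"

end

text \<open>The field of rational functions is itself an object, so the notion is not vacuous.\<close>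

lemma fixing_subgroup_antimono: "m \<le> n \<Longrightarrow> fixing_subgroup n \<subseteq> fixing_subgroup m"
  by (auto simp: fixing_subgroup_def)

lemma smooth_common:
  assumes "\<exists>n. \<forall>\<sigma>\<in>fixing_subgroup n. P \<sigma>" "\<exists>n. \<forall>\<sigma>\<in>fixing_subgroup n. Q \<sigma>"
  shows "\<exists>n. \<forall>\<sigma>\<in>fixing_subgroup n. P \<sigma> \<and> Q \<sigma>"
proof -
  obtain m n where "\<forall>\<sigma>\<in>fixing_subgroup m. P \<sigma>" "\<forall>\<sigma>\<in>fixing_subgroup n. Q \<sigma>"
    using assms by blast
  then have "\<forall>\<sigma>\<in>fixing_subgroup (max m n). P \<sigma> \<and> Q \<sigma>"
    using fixing_subgroup_antimono[of m "max m n"] fixing_subgroup_antimono[of n "max m n"] by auto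
  then show ?thesis by blast
qed

lemma perm_monom_smooth: "\<exists>n. \<forall>\<sigma>\<in>fixing_subgroup n. perm_monom \<sigma> m = m"
proof (induction m rule: poly_mapping_add_induct)
  case (add i e m)
  have "\<exists>n. \<forall>\<sigma>\<in>fixing_subgroup n. \<sigma> \<langle>$\<rangle> i = i"
    by (intro exI[of _ "Suc i"]) (simp add: fixing_subgroup_def)
  from smooth_common[OF this add] show ?case
    by (metis perm_monom_add perm_monom_single)
qed simp

lemma perm_poly_smooth:
  "\<exists>n. \<forall>\<sigma>\<in>fixing_subgroup n. perm_poly \<sigma> p = (p :: 'k::monoid_add mpoly)"
proof (induction p rule: poly_mapping_add_induct)
  case (add m c p)
  from smooth_common[OF perm_monom_smooth[of m] add] show ?case
    by (metis perm_poly_add perm_poly_single)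
qed simp

lemma perm_rat_smooth: "\<exists>n. \<forall>\<sigma>\<in>fixing_subgroup n. perm_rat \<sigma> a = a"
proof (cases a)
  case (Fract p q)
  from smooth_common[OF perm_poly_smooth[of p] perm_poly_smooth[of q]]
  show ?thesis unfolding Fract by (metis perm_rat_Fract)
qed

lemma smooth_semilinear_rep_ratfun:
  "smooth_semilinear_rep ((*) :: 'k::field ratfun \<Rightarrow> _) perm_rat"
proof unfold_locales
qed (auto simp: algebra_simps perm_rat_mult_perm perm_rat_add perm_rat_mult intro: perm_rat_smooth)

end

theory Submission
  imports Complex_Main Defs
begin

text \<open>
  Let the generators \<open>g\<^sub>i\<close> be fixed by \<open>\<SS>\<^sup>n\<close>. Then \<open>\<sigma> g\<^sub>i\<close> depends only on the word
  \<open>(i, \<sigma> 0, \<dots>, \<sigma> (n - 1))\<close>. Words of equal length are well-ordered lexicographically, and every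
  strictly increasing map of indices is compatible with this order and agrees with a finitary
  permutation on any given finite set. Hence the leading words of the elements of a subobject are
  closed under strictly increasing maps. As \<open>\<K>\<close> is a field, nested subobjects with the same
  leading words are equal. By Dickson's lemma, applied to the differences of the letters, the
  words form a well-quasi-order under strictly increasing maps, which gives the ascending chain
  condition.
\<close>

section \<open>Well-quasi-ordering of words\<close>

text \<open>A monotone subsequence always exists. If it is decreasing, then in \<nat> it is constant
  from the index where its minimum is attained, hence weakly increasing from there on.\<close>

lemma nat_incseq_subseq:
  fixes g :: "nat \<Rightarrow> nat"
  obtains r :: "nat \<Rightarrow> nat" where "strict_mono r" "incseq (\<lambda>k. g (r k))"
proof -
  obtain r :: "nat \<Rightarrow> nat" where r: "strict_mono r" "monoseq (\<lambda>k. g (r k))"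
    using seq_monosub by blast
  consider "incseq (\<lambda>k. g (r k))" | "decseq (\<lambda>k. g (r k))"
    using r(2) by (auto simp: monoseq_iff)
  then show thesis
  proof cases
    case 1
    with r that show thesis by blast
  next
    case 2
    obtain N where N: "\<And>k. g (r N) \<le> g (r k)"
      using ex_has_least_nat[of "\<lambda>_. True" undefined "\<lambda>k. g (r k)"] by blast
    have "g (r (k + N)) = g (r N)" for k
      using decseqD[OF 2, of N "k + N"] N[of "k + N"] by simp
    then have "incseq (\<lambda>k. g (r (k + N)))"
      by (simp add: incseq_def)
    moreover have "strict_mono (\<lambda>k. r (k + N))"
      using r(1) by (simp add: strict_mono_def)
    ultimately show thesis using that[of "\<lambda>k. r (k + N)"] by blast
  qed
qed

text \<open>One function is treated at a time; passing to a further subsequence keeps the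
  monotonicity already achieved.\<close>

lemma nat_incseq_subseq_finite:
  fixes G :: "(nat \<Rightarrow> nat) set"
  assumes "finite G"
  shows "\<exists>r. strict_mono r \<and> (\<forall>g\<in>G. incseq (\<lambda>k. g (r k)))"
  using assms
proof induction
  case empty
  show ?case by (auto intro: exI[of _ id] simp: strict_mono_def)
next
  case (insert g G)
  then obtain r where r: "strict_mono r" "\<forall>g\<in>G. incseq (\<lambda>k. g (r k))" by blast
  obtain s where s: "strict_mono s" "incseq (\<lambda>k. g (r (s k)))"
    using nat_incseq_subseq[of "\<lambda>k. g (r k)"] by blast
  have "incseq (\<lambda>k. h (r (s k)))" if "h \<in> G" for h
    using r(2) that s(1) by (auto simp: incseq_def strict_mono_less_eq)
  with r(1) s show ?case
    by (intro exI[of _ "\<lambda>k. r (s k)"]) (auto simp: strict_mono_def)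
qed

text \<open>A strictly increasing self-map of \<nat> never lowers a number nor shrinks a gap;
  conversely \<open>le\<close> and \<open>diff\<close> suffice to build one. Subtraction is
  truncated, so \<open>diff\<close> says something only where
  \<open>xs ! q < xs ! p\<close>.\<close>

lemma strict_mono_extension:
  fixes xs ys :: "nat list"
  assumes len: "length ys = length xs" and "distinct xs"
    and le: "\<And>p. p < length xs \<Longrightarrow> xs ! p \<le> ys ! p"
    and diff: "\<And>p q. p < length xs \<Longrightarrow> q < length xs \<Longrightarrow> xs ! p - xs ! q \<le> ys ! p - ys ! q"
  shows "\<exists>f. strict_mono f \<and> ys = map f xs"
proof -
  \<comment> \<open>Each prescribed value is continued to the right with slope 1, and
    \<open>f\<close> is the upper envelope of these lines and the identity. The element
    \<open>x\<close> also covers the numbers to the left of all prescribed points.\<close>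
  define S where "S x = insert x {ys ! q + (x - xs ! q) | q. q < length xs \<and> xs ! q \<le> x}" for x
  define f where "f x = Max (S x)" for x
  have fin: "finite (S x)" for x
  proof -
    have "S x \<subseteq> insert x ((\<lambda>q. ys ! q + (x - xs ! q)) ` {..<length xs})"
      by (auto simp: S_def)
    then show ?thesis by (rule finite_subset) simp
  qed
  have ne: "S x \<noteq> {}" for x by (simp add: S_def)
  have "f x < f y" if "x < y" for x y
  proof -
    have "f x \<in> S x" unfolding f_def by (rule Max_in[OF fin ne])
    \<comment> \<open>The line that realises the maximum at \<open>x\<close> is still present at
      \<open>y\<close>, so \<open>f\<close> grows at least with slope 1.\<close>
    then have "f x + (y - x) \<in> S y"
    proof (unfold S_def[of x], elim insertE CollectE exE conjE)
      fix q assume "f x = ys ! q + (x - xs ! q)" "q < length xs" "xs ! q \<le> x"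
      then have "f x + (y - x) = ys ! q + (y - xs ! q)" "q < length xs" "xs ! q \<le> y"
        using that by simp_all
      then show ?thesis unfolding S_def by blast
    qed (use that in \<open>simp add: S_def\<close>)
    then have "f x + (y - x) \<le> f y" unfolding f_def[of y] by (rule Max_ge[OF fin])
    with that show ?thesis by simp
  qed
  moreover have "f (xs ! p) = ys ! p" if p: "p < length xs" for p
    unfolding f_def
  proof (rule Max_eqI[OF fin])
    show "ys ! p \<in> S (xs ! p)"
      using p unfolding S_def by (intro insertI2 CollectI exI[of _ p]) simp
    fix z assume "z \<in> S (xs ! p)"
    then consider "z = xs ! p"
      | q where "q < length xs" "xs ! q \<le> xs ! p" "z = ys ! q + (xs ! p - xs ! q)"
      by (auto simp: S_def)
    then show "z \<le> ys ! p"
    proof cases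
      case 1
      with le p show ?thesis by simp
    next
      case 2
      show ?thesis
      proof (cases "p = q")
        case False
        \<comment> \<open>Strictness makes the left side of \<open>diff\<close> positive, so the
          truncated difference on its right is a true one.\<close>
        with 2 p \<open>distinct xs\<close> have "xs ! q < xs ! p"
          by (simp add: nat_less_le nth_eq_iff_index_eq)
        with diff[OF p 2(1)] 2 show ?thesis by simp
      qed (use 2 in simp)
    qed
  qed
  ultimately show ?thesis
    by (intro exI[of _ f]) (auto simp: strict_mono_def len intro!: nth_equalityI)
qed

lemma words_wqo:
  fixes h :: "nat \<Rightarrow> nat" and w :: "nat \<Rightarrow> nat list"
  assumes h: "\<And>k. h k < b" and len: "\<And>k. length (w k) = n" and dist: "\<And>k. distinct (w k)"
  shows "\<exists>k l f. k < l \<and> strict_mono f \<and> h l = h k \<and> w l = map f (w k)"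
proof -
  \<comment> \<open>Since \<open>h\<close> is bounded by \<open>b\<close>, monotonicity of both
    \<open>h\<close> and \<open>b - h\<close> forces equal values of \<open>h\<close>. The remaining
    members supply the hypotheses \<open>le\<close> and \<open>diff\<close> of the extension
    lemma.\<close>
  define G where "G = {h, \<lambda>k. b - h k} \<union> (\<lambda>p k. w k ! p) ` {..<n}
    \<union> (\<lambda>(p, q) k. w k ! p - w k ! q) ` ({..<n} \<times> {..<n})"
  have "finite G" by (simp add: G_def)
  then obtain r where r: "strict_mono r" and inc: "\<And>g. g \<in> G \<Longrightarrow> incseq (\<lambda>k. g (r k))"
    using nat_incseq_subseq_finite by blast
  have step: "g (r 0) \<le> g (r 1)" if "g \<in> G" for g
    using incseqD[OF inc[OF that], of 0 1] by simp
  have "h (r 0) \<le> h (r 1)" "b - h (r 0) \<le> b - h (r 1)"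
    by (rule step, simp add: G_def)+
  with h[of "r 0"] h[of "r 1"] have "h (r 1) = h (r 0)" by simp
  moreover have "\<exists>f. strict_mono f \<and> w (r 1) = map f (w (r 0))"
  proof (rule strict_mono_extension)
    fix p q assume p: "p < length (w (r 0))"
    then show "w (r 0) ! p \<le> w (r 1) ! p"
      using step[of "\<lambda>k. w k ! p"] by (auto simp: G_def len)
    assume "q < length (w (r 0))"
    with p have "(\<lambda>k. w k ! p - w k ! q) \<in> G" by (force simp: G_def len)
    from step[OF this] show "w (r 0) ! p - w (r 0) ! q \<le> w (r 1) ! p - w (r 1) ! q" .
  qed (simp_all add: len dist)
  moreover have "r 0 < r 1" using r by (simp add: strict_mono_def)
  ultimately show ?thesis by blast
qed

section \<open>Order preservation and realisation by finitary permutations\<close>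

lemma lenlex_map_strict_mono:
  assumes "strict_mono f" "(xs, ys) \<in> lenlex less_than"
  shows "(map f xs, map f ys) \<in> lenlex less_than"
  using assms(2)
proof (induction xs arbitrary: ys)
  case (Cons x xs)
  then show ?case
    by (cases ys) (auto simp: Cons_lenlex_iff strict_mono_less[OF assms(1)])
qed auto

text \<open>\<open>A\<close> and its image have equal cardinality, hence so do their complements in
  the finite union \<open>?B\<close>. A bijection between these complements completes
  \<open>f\<close> to a permutation of \<open>?B\<close>, extended by the identity.\<close>

lemma perm_extends_inj_on:
  assumes "finite A" "inj_on f A"
  shows "\<exists>\<pi> :: 'a perm. \<forall>x\<in>A. \<pi> \<langle>$\<rangle> x = f x"
proof -
  let ?B = "A \<union> f ` A"
  have fin: "finite ?B" using assms(1) by simp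
  have "card (?B - A) = card (?B - f ` A)"
    using assms by (simp add: card_Diff_subset card_image)
  then obtain g where g: "bij_betw g (?B - A) (?B - f ` A)"
    using finite_same_card_bij[of "?B - A" "?B - f ` A"] fin by blast
  define p where "p x = (if x \<in> A then f x else if x \<in> ?B then g x else x)" for x
  have "bij_betw p A (f ` A)"
    using assms(2) by (auto simp: bij_betw_def p_def inj_on_def)
  moreover have "bij_betw p (?B - A) (?B - f ` A)"
    using g by (subst bij_betw_cong[of _ p g]) (auto simp: p_def)
  ultimately have "bij_betw p (A \<union> (?B - A)) (f ` A \<union> (?B - f ` A))"
    by (rule bij_betw_combine) auto
  moreover have "A \<union> (?B - A) = ?B" "f ` A \<union> (?B - f ` A) = ?B" by auto
  ultimately have inside: "bij_betw p ?B ?B" by simp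
  have outside: "bij_betw p (- ?B) (- ?B)"
    by (subst bij_betw_cong[of _ p id]) (auto simp: p_def)
  from bij_betw_combine[OF inside outside] have "bij_betw p (?B \<union> - ?B) (?B \<union> - ?B)"
    by blast
  then have "bij p" unfolding Compl_partition .
  moreover have "finite {x. p x \<noteq> x}"
    by (rule finite_subset[OF _ fin]) (auto simp: p_def)
  ultimately have "Perm p \<langle>$\<rangle> x = p x" for x
    by (simp add: Perm_inverse)
  then show ?thesis by (intro exI[of _ "Perm p"]) (simp add: p_def)
qed


section \<open>Leading words\<close>

context smooth_semilinear_rep
begin

section \<open>Orbit spans and uniform smoothness\<close>

lemma act_zero [simp]: "act \<sigma> 0 = 0"
  using act_add[of \<sigma> 0 0] by simp

lemma subobject_orbit_span: "subobject (span {act \<sigma> v | \<sigma> v. v \<in> G})"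
  unfolding subobject_def
proof (intro conjI allI ballI subspace_span)
  fix \<sigma> x assume "x \<in> span {act \<sigma> v | \<sigma> v. v \<in> G}"
  then show "act \<sigma> x \<in> span {act \<sigma> v | \<sigma> v. v \<in> G}"
  proof (induction rule: span_induct_alt)
    case (step c x y)
    then obtain \<tau> v where "x = act \<tau> v" "v \<in> G" by blast
    then have "act \<sigma> x \<in> {act \<sigma> v | \<sigma> v. v \<in> G}"
      by (auto simp flip: act_mult)
    then show ?case
      using step by (simp add: act_add act_scale span_add span_scale span_base)
  qed (simp add: span_zero)
qed

lemma Union_finitely_generated: "\<Union> {N. subobject N \<and> finitely_generated N} = UNIV"
proof -
  have "\<exists>N. subobject N \<and> finitely_generated N \<and> v \<in> N" for v
  proof (intro exI conjI)
    show "subobject (span {act \<sigma> u | \<sigma> u. u \<in> {v}})" by (rule subobject_orbit_span)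
    show "finitely_generated (span {act \<sigma> u | \<sigma> u. u \<in> {v}})"
      unfolding finitely_generated_def by (intro exI[of _ "{v}"]) simp
    have "act 1 v \<in> {act \<sigma> u | \<sigma> u. u \<in> {v}}" by blast
    from span_base[OF this] show "v \<in> span {act \<sigma> u | \<sigma> u. u \<in> {v}}"
      by (simp only: act_one)
  qed
  then show ?thesis by blast
qed

text \<open>Supplies one \<open>n\<close> for all generators, so that all words have the same
  length.\<close>

lemma smooth_finite:
  assumes "finite G"
  shows "\<exists>n. \<forall>v\<in>G. \<forall>\<sigma>\<in>fixing_subgroup n. act \<sigma> v = v"
  using assms
proof induction
  case (insert v G)
  then have "\<exists>n. \<forall>\<sigma>\<in>fixing_subgroup n. \<forall>v\<in>G. act \<sigma> v = v" by blast
  from smooth_common[OF smooth[of v] this] show ?case by auto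
qed simp

section \<open>Words, the filtration by words, and leading terms\<close>

context
  fixes gs :: "'m list" and n :: nat
  assumes gs_fixed: "\<And>v \<sigma>. v \<in> set gs \<Longrightarrow> \<sigma> \<in> fixing_subgroup n \<Longrightarrow> act \<sigma> v = v"
begin

text \<open>A complete invariant of the left coset of \<sigma> modulo
  \<open>fixing_subgroup n\<close>.\<close>

definition word :: "nat perm \<Rightarrow> nat list" where
  "word \<sigma> = map (apply \<sigma>) [0..<n]"

text \<open>The bound \<open>w\<close> may be any list, not only an indexed word, so that one long
  list can lie above all indexed words.\<close>

definition below :: "nat list \<Rightarrow> 'm set" where
  "below w = span {act \<sigma> (gs ! i) | i \<sigma>. i < length gs \<and> (i # word \<sigma>, w) \<in> lenlex less_than}"

text \<open>The leading coefficient is normalised to 1. The translates of generators may be linearly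
  dependent: if \<open>act \<sigma> (gs ! i)\<close> lies in
  \<open>below (i # word \<sigma>)\<close>, the sum can be 0 and the word is leading for every
  subobject.\<close>

definition leading_words :: "'m set \<Rightarrow> nat list set" where
  "leading_words N = {i # word \<sigma> | i \<sigma>. i < length gs \<and>
    (\<exists>u \<in> below (i # word \<sigma>). act \<sigma> (gs ! i) + u \<in> N)}"

text \<open>The permutation \<open>inverse \<tau> * \<sigma>\<close> fixes all numbers less than
  \<open>n\<close>, hence fixes each generator.\<close>

lemma act_eq_of_word_eq:
  assumes "word \<sigma> = word \<tau>" "i < length gs"
  shows "act \<sigma> (gs ! i) = act \<tau> (gs ! i)"
proof -
  have "\<sigma> \<langle>$\<rangle> x = \<tau> \<langle>$\<rangle> x" if "x < n" for x
    using assms(1) that by (simp add: word_def)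
  moreover have "inverse \<tau> \<langle>$\<rangle> (\<tau> \<langle>$\<rangle> x) = x" for x
    by (simp add: apply_sequence)
  ultimately have "inverse \<tau> * \<sigma> \<in> fixing_subgroup n"
    by (simp add: fixing_subgroup_def apply_times)
  then have "act (inverse \<tau> * \<sigma>) (gs ! i) = gs ! i"
    using assms(2) by (intro gs_fixed) simp_all
  then have "act \<tau> (act (inverse \<tau> * \<sigma>) (gs ! i)) = act \<tau> (gs ! i)" by simp
  then show ?thesis
    by (simp flip: act_mult mult.assoc)
qed

lemma word_mult:
  assumes "\<And>x. x \<in> set (word \<sigma>) \<Longrightarrow> \<pi> \<langle>$\<rangle> x = f x"
  shows "word (\<pi> * \<sigma>) = map f (word \<sigma>)"
  using assms by (simp add: word_def apply_times)

lemma below_mono: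
  assumes "(w, w') \<in> lenlex less_than"
  shows "below w \<subseteq> below w'"
  unfolding below_def
  using assms by (intro span_mono) (blast intro: lenlex_trans)

lemma subspace_below: "subspace (below w)"
  by (simp add: below_def)

text \<open>A new term is compared with the leading term of the rest: equal words merge, a smaller
  word is absorbed into \<open>u\<close>, a larger one takes the lead. The coefficient
  \<open>c\<close> may vanish by cancellation; what counts is that the word strictly precedes
  \<open>w\<close>.\<close>

lemma below_leading_term:
  assumes "v \<in> below w" "v \<noteq> 0"
  shows "\<exists>i \<sigma> c u. i < length gs \<and> (i # word \<sigma>, w) \<in> lenlex less_than \<and>
    u \<in> below (i # word \<sigma>) \<and> v = scale c (act \<sigma> (gs ! i)) + u"
  using assms unfolding below_def[of w]
proof (induction rule: span_induct_alt)
  case (step c x y)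
  then obtain i \<sigma> where x: "x = act \<sigma> (gs ! i)" and i: "i < length gs"
    and w: "(i # word \<sigma>, w) \<in> lenlex less_than" by blast
  show ?case
  proof (cases "y = 0")
    case True
    with x i w show ?thesis
      by (intro exI[of _ i] exI[of _ \<sigma>] exI[of _ c] exI[of _ 0])
        (simp add: subspace_0[OF subspace_below])
  next
    case False
    with step.IH obtain j \<tau> d u where y: "y = scale d (act \<tau> (gs ! j)) + u"
      and j: "j < length gs" and w': "(j # word \<tau>, w) \<in> lenlex less_than"
      and u: "u \<in> below (j # word \<tau>)" by blast
    consider "i # word \<sigma> = j # word \<tau>" | "(i # word \<sigma>, j # word \<tau>) \<in> lenlex less_than"
      | "(j # word \<tau>, i # word \<sigma>) \<in> lenlex less_than"
      using total_lenlex[OF total_less_than] unfolding total_on_def by blast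
    then show ?thesis
    proof cases
      case 1
      then have "x = act \<tau> (gs ! j)" using act_eq_of_word_eq[of \<sigma> \<tau> i] i x by simp
      then have "scale c x + y = scale (c + d) (act \<tau> (gs ! j)) + u"
        by (simp add: y scale_left_distrib add.assoc)
      with j w' u show ?thesis by blast
    next
      case 2
      with i x have "x \<in> below (j # word \<tau>)"
        unfolding below_def by (blast intro: span_base)
      with u have "scale c x + u \<in> below (j # word \<tau>)"
        by (intro subspace_add[OF subspace_below] subspace_scale[OF subspace_below])
      moreover have "scale c x + y = scale d (act \<tau> (gs ! j)) + (scale c x + u)"
        by (simp add: y algebra_simps)
      ultimately show ?thesis using j w' by blast
    next
      case 3
      with j have "act \<tau> (gs ! j) \<in> below (i # word \<sigma>)"
        unfolding below_def by (blast intro: span_base)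
      moreover have "u \<in> below (i # word \<sigma>)" using u below_mono[OF 3] by blast
      ultimately have "y \<in> below (i # word \<sigma>)" unfolding y
        by (intro subspace_add[OF subspace_below] subspace_scale[OF subspace_below])
      with i w x show ?thesis by blast
    qed
  qed
qed simp

section \<open>Transport along strictly increasing maps\<close>

text \<open>The map \<open>f\<close> need not be a permutation, but \<open>u\<close> involves
  finitely many words. The set \<open>A\<close> collects their letters, and a permutation that
  agrees with \<open>f\<close> there preserves all the comparisons; coefficients change but remain
  scalars.\<close>

lemma below_act_strict_mono:
  assumes f: "strict_mono f" and u: "u \<in> below (i # xs)"
  shows "\<exists>A. finite A \<and> (\<forall>\<pi>. (\<forall>x\<in>A. \<pi> \<langle>$\<rangle> x = f x) \<longrightarrow> act \<pi> u \<in> below (i # map f xs))"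
  using u unfolding below_def[of "i # xs"]
proof (induction rule: span_induct_alt)
  case base
  then show ?case
    by (intro exI[of _ "{}"]) (simp add: subspace_0[OF subspace_below])
next
  case (step c x y)
  then obtain j \<sigma> where x: "x = act \<sigma> (gs ! j)" and j: "j < length gs"
    and w: "(j # word \<sigma>, i # xs) \<in> lenlex less_than" by blast
  from step obtain A where A: "finite A"
    "\<And>\<pi>. \<forall>x\<in>A. \<pi> \<langle>$\<rangle> x = f x \<Longrightarrow> act \<pi> y \<in> below (i # map f xs)" by blast
  have "act \<pi> (scale c x + y) \<in> below (i # map f xs)"
    if \<pi>: "\<forall>x\<in>A \<union> set (word \<sigma>). \<pi> \<langle>$\<rangle> x = f x" for \<pi>
  proof -
    have "word (\<pi> * \<sigma>) = map f (word \<sigma>)" using \<pi> by (intro word_mult) simp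
    \<comment> \<open>The first letter is the index of a generator and is not moved by
      \<open>f\<close>, so only the tails need the order lemma.\<close>
    then have "(j # word (\<pi> * \<sigma>), i # map f xs) \<in> lenlex less_than"
      using w lenlex_map_strict_mono[OF f] by (auto simp: Cons_lenlex_iff)
    with j have "act (\<pi> * \<sigma>) (gs ! j) \<in> below (i # map f xs)"
      unfolding below_def by (blast intro: span_base)
    moreover have "act \<pi> y \<in> below (i # map f xs)" using A \<pi> by blast
    ultimately show ?thesis
      unfolding act_add act_scale x act_mult
      by (intro subspace_add[OF subspace_below] subspace_scale[OF subspace_below])
  qed
  with A(1) show ?case by (intro exI[of _ "A \<union> set (word \<sigma>)"]) blast
qed

text \<open>A single finitary permutation imitates \<open>f\<close> on the leading word and on the
  letters of the lower terms; applied to a witness in \<open>N\<close>, it gives a witness for the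
  mapped word.\<close>

lemma leading_words_map:
  assumes N: "subobject N" and f: "strict_mono f" and w: "i # xs \<in> leading_words N"
  shows "i # map f xs \<in> leading_words N"
proof -
  from w obtain \<sigma> u where i: "i < length gs" and xs: "xs = word \<sigma>"
    and u: "u \<in> below (i # xs)" "act \<sigma> (gs ! i) + u \<in> N"
    by (auto simp: leading_words_def)
  obtain A where A: "finite A"
    "\<And>\<pi>. \<forall>x\<in>A. \<pi> \<langle>$\<rangle> x = f x \<Longrightarrow> act \<pi> u \<in> below (i # map f xs)"
    using below_act_strict_mono[OF f u(1)] by blast
  obtain \<pi> where \<pi>: "\<forall>x\<in>A \<union> set xs. \<pi> \<langle>$\<rangle> x = f x"
    using perm_extends_inj_on[of "A \<union> set xs" f] A(1) f
    by (auto intro: inj_on_subset[OF strict_mono_imp_inj_on])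
  have "word (\<pi> * \<sigma>) = map f xs" unfolding xs using \<pi> xs by (intro word_mult) simp
  moreover have "act \<pi> u \<in> below (i # map f xs)" using A(2) \<pi> by blast
  moreover have "act (\<pi> * \<sigma>) (gs ! i) + act \<pi> u \<in> N"
    using N u(2) by (simp add: subobject_def act_mult flip: act_add)
  ultimately show ?thesis
    using i unfolding leading_words_def by (metis (mono_tags, lifting) mem_Collect_eq)
qed

lemma leading_words_mono: "N \<subseteq> N' \<Longrightarrow> leading_words N \<subseteq> leading_words N'"
  unfolding leading_words_def by blast

section \<open>Comparison of nested subobjects and the chain condition\<close>

text \<open>Reduction as in Groebner basis theory: subtracting a multiple of an element of
  \<open>N\<close> with the same leading word leaves a remainder in \<open>N'\<close> below an
  earlier word, and \<open>lenlex\<close> is well-founded.\<close>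

lemma below_subset_of_leading_words:
  assumes N: "subobject N" and N': "subobject N'" and sub: "N \<subseteq> N'"
    and lead: "leading_words N' \<subseteq> leading_words N"
  shows "N' \<inter> below w \<subseteq> N"
proof (induction w rule: wf_induct_rule[OF wf_lenlex[OF wf_less_than]])
  case (1 w)
  have sp: "subspace N" "subspace N'" using N N' by (simp_all add: subobject_def)
  have "v \<in> N" if v: "v \<in> N'" "v \<in> below w" for v
  proof (cases "v = 0")
    case True
    with sp show ?thesis by (simp add: subspace_0)
  next
    case False
    then obtain i \<sigma> c u where i: "i < length gs"
      and lt: "(i # word \<sigma>, w) \<in> lenlex less_than" and u: "u \<in> below (i # word \<sigma>)"
      and v_eq: "v = scale c (act \<sigma> (gs ! i)) + u"
      using below_leading_term v(2) by blast
    show ?thesis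
    proof (cases "c = 0")
      case True
      with v_eq u v(1) 1[OF lt] show ?thesis by auto
    next
      case False
      \<comment> \<open>Normalising the leading coefficient uses that the scalars form a
        field.\<close>
      have "scale (inverse c) v \<in> N'" using v(1) sp by (simp add: subspace_scale)
      then have "act \<sigma> (gs ! i) + scale (inverse c) u \<in> N'"
        using False by (simp add: v_eq scale_right_distrib)
      moreover have "scale (inverse c) u \<in> below (i # word \<sigma>)"
        using u by (rule subspace_scale[OF subspace_below])
      ultimately have "i # word \<sigma> \<in> leading_words N'"
        using i unfolding leading_words_def by blast
      with lead have "i # word \<sigma> \<in> leading_words N" by blast
      \<comment> \<open>The witness may come from another permutation \<tau>, but an equal word
        gives the same translate of the generator.\<close>
      then obtain \<tau> t where t: "word \<tau> = word \<sigma>" "t \<in> below (i # word \<sigma>)"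
        "act \<tau> (gs ! i) + t \<in> N"
        unfolding leading_words_def mem_Collect_eq list.inject by metis
      then have n: "act \<sigma> (gs ! i) + t \<in> N" using t(3) act_eq_of_word_eq[OF t(1) i] by simp
      then have cn: "scale c (act \<sigma> (gs ! i) + t) \<in> N" by (rule subspace_scale[OF sp(1)])
      have "v - scale c (act \<sigma> (gs ! i) + t) = u - scale c t"
        by (simp add: v_eq scale_right_distrib)
      moreover have "u - scale c t \<in> below (i # word \<sigma>)"
        using u t(2) by (intro subspace_diff[OF subspace_below] subspace_scale[OF subspace_below])
      moreover have "v - scale c (act \<sigma> (gs ! i) + t) \<in> N'"
        using v(1) cn sub by (intro subspace_diff[OF sp(2)]) auto
      ultimately have "v - scale c (act \<sigma> (gs ! i) + t) \<in> N"
        using 1[OF lt] by auto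
      with cn have "(v - scale c (act \<sigma> (gs ! i) + t)) + scale c (act \<sigma> (gs ! i) + t) \<in> N"
        by (intro subspace_add[OF sp(1)])
      then show ?thesis by simp
    qed
  qed
  then show ?case by blast
qed

text \<open>A chain that never stabilises yields an infinite sequence of leading words, each new at
  its own stage; the well-quasi-order makes a later one the image of an earlier one, which
  contradicts its novelty.\<close>

lemma acc_of_generators:
  assumes gen: "span {act \<sigma> v | \<sigma> v. v \<in> set gs} = UNIV"
  shows "acc_on_subobjects UNIV"
  unfolding acc_on_subobjects_def
proof (intro allI impI, rule ccontr)
  fix C :: "nat \<Rightarrow> 'm set"
  assume "\<forall>i. subobject (C i) \<and> C i \<subseteq> UNIV \<and> C i \<subseteq> C (Suc i)"
  then have sub: "subobject (C i)" and mono: "i \<le> j \<Longrightarrow> C i \<subseteq> C j" for i j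
    using lift_Suc_mono_le[of C i j] by simp_all
  \<comment> \<open>\<open>lenlex\<close> compares lengths first, so every word in use precedes this one.\<close>
  let ?w = "replicate (n + 2) (0 :: nat)"
  have "{act \<sigma> v | \<sigma> v. v \<in> set gs} \<subseteq>
      {act \<sigma> (gs ! i) | i \<sigma>. i < length gs \<and> (i # word \<sigma>, ?w) \<in> lenlex less_than}"
    by (auto simp: lenlex_conv word_def in_set_conv_nth)
  then have top: "below ?w = UNIV"
    using gen span_mono unfolding below_def by blast
  assume "\<nexists>n. \<forall>i\<ge>n. C i = C n"
  then have "\<forall>n. \<exists>i\<ge>n. C i \<noteq> C n" by blast
  \<comment> \<open>As \<open>below ?w\<close> is everything, inclusion of leading words would force
    \<open>C i = C n\<close>.\<close>
  then have "\<forall>n. \<exists>i\<ge>n. \<not> leading_words (C i) \<subseteq> leading_words (C n)"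
    using below_subset_of_leading_words[OF sub sub mono, of _ _ ?w] mono top
    by (metis Int_UNIV_right subset_antisym)
  then have "\<forall>n. \<exists>i t. n \<le> i \<and> t \<in> leading_words (C i) \<and> t \<notin> leading_words (C n)"
    by blast
  then obtain s t where s: "\<And>n. n \<le> s n" and t: "\<And>n. t n \<in> leading_words (C (s n))"
    and t': "\<And>n. t n \<notin> leading_words (C n)" by metis
  \<comment> \<open>Iterating \<open>s\<close> makes the word that is new at stage
    \<open>k m\<close> a leading word by stage \<open>k (Suc m)\<close>.\<close>
  define k where "k m = (s ^^ m) 0" for m
  have kSuc: "k (Suc m) = s (k m)" for m by (simp add: k_def)
  have k_mono: "a \<le> b \<Longrightarrow> k a \<le> k b" for a b
    by (rule lift_Suc_mono_le) (simp_all add: kSuc s)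
  have "\<forall>m. \<exists>i \<sigma>. i < length gs \<and> t (k m) = i # word \<sigma>"
    using t unfolding leading_words_def by blast
  then obtain h \<rho> where h: "\<And>m. h m < length gs" "\<And>m. t (k m) = h m # word (\<rho> m)"
    by metis
  have "distinct (word \<sigma>)" for \<sigma>
    by (simp add: word_def distinct_map inj_on_subset[OF inj_apply])
  then obtain a b f where ab: "a < b" "strict_mono f" "h b = h a" "word (\<rho> b) = map f (word (\<rho> a))"
    using words_wqo[of h "length gs" "\<lambda>m. word (\<rho> m)" n] h(1) by (auto simp: word_def)
  have "t (k a) \<in> leading_words (C (k (Suc a)))" using t by (simp add: kSuc)
  then have "t (k a) \<in> leading_words (C (k b))"
    using ab(1) leading_words_mono[OF mono[OF k_mono[of "Suc a" b]]] by auto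
  then have "t (k b) \<in> leading_words (C (k b))"
    using leading_words_map[OF sub ab(2)] h(2) ab by simp
  with t' show False by blast
qed

end

lemma finitely_generated_imp_acc:
  assumes "finitely_generated UNIV"
  shows "acc_on_subobjects UNIV"
proof -
  obtain G where G: "finite G" "span {act \<sigma> v | \<sigma> v. v \<in> G} = UNIV"
    using assms unfolding finitely_generated_def by blast
  obtain gs where gs: "set gs = G" using finite_list[OF G(1)] by blast
  obtain n where "\<forall>v\<in>G. \<forall>\<sigma>\<in>fixing_subgroup n. act \<sigma> v = v"
    using smooth_finite[OF G(1)] by blast
  then show ?thesis
    using G(2) gs by (intro acc_of_generators[of gs n]) auto
qed

end

theorem proposition2p6:
  fixes scale :: "'k::field ratfun \<Rightarrow> 'm::ab_group_add \<Rightarrow> 'm"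
    and act :: "nat perm \<Rightarrow> 'm \<Rightarrow> 'm"
  assumes "smooth_semilinear_rep scale act"
  shows "\<Union> {N. smooth_semilinear_rep.subobject scale act N \<and>
              smooth_semilinear_rep.finitely_generated scale act N} = UNIV \<and>
         (smooth_semilinear_rep.finitely_generated scale act UNIV \<longrightarrow>
            smooth_semilinear_rep.acc_on_subobjects scale act UNIV)"
proof -
  interpret smooth_semilinear_rep scale act by fact
  show ?thesis
    using Union_finitely_generated finitely_generated_imp_acc by blast
qed

end
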